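(* Let $\mathbf{k}$ be a commutative ring and $n\in\mathbb{N}$. Let $Q_1,Q_2,\ldots,Q_{f_{n+1}}$ be all the lacunar subsets of $[n-1]$, listed without repetition in an order satisfying $\operatorname{sum}(Q_1)\le\operatorname{sum}(Q_2)\le\cdots\le\operatorname{sum}(Q_{f_{n+1}})$. For each $i\in\{0,1,\ldots,f_{n+1}\}$, let $F_i:=F(Q_1)+F(Q_2)+\cdots+F(Q_i)$, a $\mathbf{k}$-submodule of $\mathbf{k}[S_n]$ (so $F_0=0$). Then: (a) $0=F_0\subseteq F_1\subseteq F_2\subseteq\cdots\subseteq F_{f_{n+1}}=\mathbf{k}[S_n]$. (b) $F_i\cdot t_\ell\subseteq F_i$ for each $i\in\{0,1,\ldots,f_{n+1}\}$ and $\ell\in[n]$. (c) For each $i\in\{1,\ldots,f_{n+1}\}$ and $\ell\in[n]$, we have $F_i\cdot(t_\ell-m_{Q_i,\ell})\subseteq F_{i-1}$.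
   Context: $\mathbb{N}=\{0,1,2,\ldots\}$; $[m]=\{1,\ldots,m\}$ (empty if $m\le 0$). $S_n$ is the group of permutations of $[n]$, with product $(\pi\sigma)(i)=\pi(\sigma(i))$; $\mathbf{k}[S_n]$ is its group algebra. For distinct $i_1,\ldots,i_k\in[n]$, $\operatorname{cyc}_{i_1,\ldots,i_k}\in S_n$ sends $i_1,\ldots,i_{k-1},i_k$ to $i_2,\ldots,i_k,i_1$, respectively, and fixes all other elements. For $\ell\in[n]$, $t_\ell:=\operatorname{cyc}_\ell+\operatorname{cyc}_{\ell,\ell+1}+\cdots+\operatorname{cyc}_{\ell,\ell+1,\ldots,n}\in\mathbf{k}[S_n]$. For $i\in[n-1]$, $s_i:=\operatorname{cyc}_{i,i+1}$. $(f_0,f_1,\ldots)$ is the Fibonacci sequence: $f_0=0$, $f_1=1$, $f_m=f_{m-1}+f_{m-2}$ for $m\ge2$. A set of integers is lacunar if it contains no two consecutive integers. The number of lacunar subsets of $[n-1]$ is $f_{n+1}$. For a finite set $I$ of integers, $\operatorname{sum}I$ is the sum of its elements. For $I\subseteq[n]$: let $\widehat I:=\{0\}\cup I\cup\{n+1\}$; for $\ell\in[n]$ let $m_{I,\ell}:=(\text{smallest element of }\widehat I\text{ that is}\ge\ell)-\ell$; let $I':=\{i\in[n-1]\mid i\notin I\text{ and }i+1\notin I\}$; and let $F(I):=\{q\in\mathbf{k}[S_n]\mid qs_i=q\text{ for all }i\in I'\}$. *)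

theory Defs
  imports
    "HOL-Combinatorics.Cycles"
    "HOL-Number_Theory.Fib"
    "HOL-Library.Set_Algebras"
    "HOL-Library.Function_Algebras"
begin

text \<open>
  An element of the group algebra of the symmetric group \<open>S\<^sub>n\<close> is represented by its coefficient
  function, which vanishes outside \<open>S\<^sub>n\<close>.  Addition, subtraction and zero are the pointwise ones
  from \<open>Function_Algebras\<close>; the product is \<open>gmult\<close>, and never the pointwise \<open>*\<close>.

  The sort \<open>{comm_ring, comm_monoid_mult}\<close> is that of commutative rings with unity in which
  \<open>0 = 1\<close> is allowed; \<open>comm_ring_1\<close> would exclude the trivial ring.
\<close>

definition sym_group :: "nat \<Rightarrow> (nat \<Rightarrow> nat) set" where
  "sym_group n = {p. p permutes {1..n}}"

definition group_algebra :: "nat \<Rightarrow> ((nat \<Rightarrow> nat) \<Rightarrow> 'k :: {comm_ring, comm_monoid_mult}) set" where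
  "group_algebra n = {a. \<forall>p. p \<notin> sym_group n \<longrightarrow> a p = 0}"

definition gbasis :: "(nat \<Rightarrow> nat) \<Rightarrow> (nat \<Rightarrow> nat) \<Rightarrow> 'k :: {comm_ring, comm_monoid_mult}" where
  "gbasis w = (\<lambda>p. if p = w then 1 else 0)"

definition gmult :: "nat \<Rightarrow> ((nat \<Rightarrow> nat) \<Rightarrow> 'k) \<Rightarrow> ((nat \<Rightarrow> nat) \<Rightarrow> 'k) \<Rightarrow>
    (nat \<Rightarrow> nat) \<Rightarrow> 'k :: {comm_ring, comm_monoid_mult}" where
  "gmult n a b = (\<lambda>p. \<Sum>(\<sigma>, \<tau>) \<in> {(\<sigma>, \<tau>) \<in> sym_group n \<times> sym_group n. \<sigma> \<circ> \<tau> = p}. a \<sigma> * b \<tau>)"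

text \<open>The image of the natural number \<open>m\<close> in the group algebra, i.e. \<open>m\<close> times its unity.\<close>

definition gnat :: "nat \<Rightarrow> (nat \<Rightarrow> nat) \<Rightarrow> 'k :: {comm_ring, comm_monoid_mult}" where
  "gnat m = (\<Sum>j<m. gbasis id)"

definition somewhere_to_below :: "nat \<Rightarrow> nat \<Rightarrow> (nat \<Rightarrow> nat) \<Rightarrow> 'k :: {comm_ring, comm_monoid_mult}" where
  "somewhere_to_below n l = (\<Sum>j\<in>{l..n}. gbasis (cycle_of_list [l..<Suc j]))"

definition lacunar :: "nat set \<Rightarrow> bool" where
  "lacunar I \<longleftrightarrow> (\<forall>i\<in>I. i + 1 \<notin> I)"

definition hat :: "nat \<Rightarrow> nat set \<Rightarrow> nat set" where
  "hat n I = {0} \<union> I \<union> {n + 1}"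

definition mdist :: "nat \<Rightarrow> nat set \<Rightarrow> nat \<Rightarrow> nat" where
  "mdist n I l = (LEAST x. x \<in> hat n I \<and> l \<le> x) - l"

definition nonshadow :: "nat \<Rightarrow> nat set \<Rightarrow> nat set" where
  "nonshadow n I = {i \<in> {1..n - 1}. i \<notin> I \<and> i + 1 \<notin> I}"

definition invariants :: "nat \<Rightarrow> nat set \<Rightarrow> ((nat \<Rightarrow> nat) \<Rightarrow> 'k :: {comm_ring, comm_monoid_mult}) set" where
  "invariants n I =
     {q \<in> group_algebra n. \<forall>i \<in> nonshadow n I. gmult n q (gbasis (cycle_of_list [i, i + 1])) = q}"

end

theory Submission
  imports Defs
begin

text \<open>
  Write \<open>c\<^sub>j\<close> for the cycle on \<open>l, l + 1, \<dots>, j\<close>, so that \<open>t\<^sub>l = c\<^sub>l + \<dots> + c\<^sub>n\<close>, and let \<open>q \<in> F(I)\<close>.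
  Let \<open>k\<close> be the smallest element of \<open>I \<union> {n + 1}\<close> with \<open>k \<ge> l\<close>.  Since
  \<open>c\<^sub>j = s\<^sub>l s\<^sub>l\<^sub>+\<^sub>1 \<cdots> s\<^sub>j\<^sub>-\<^sub>1\<close>, and \<open>q\<close> absorbs the reflections \<open>s\<^sub>l, \<dots>, s\<^sub>k\<^sub>-\<^sub>2\<close>, each of the \<open>k - l\<close>
  terms \<open>q c\<^sub>j\<close> with \<open>j < k\<close> equals \<open>q\<close>; these terms produce the scalar \<open>m\<^sub>I\<^sub>,\<^sub>l\<close>.  What remains is
  to see that the sum of the terms with \<open>j \<ge> k\<close> lies in the sum of the spaces \<open>F(J)\<close>
  with \<open>sum J < sum I\<close>.  In these terms \<open>q\<close> absorbs \<open>s\<^sub>l, \<dots>, s\<^sub>k\<^sub>-\<^sub>2\<close> as well, so that \<open>l\<close> may be assumed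
  to be \<open>k\<close> or \<open>k - 1\<close>.

  The elements of \<open>I\<close> cut the range \<open>k \<le> j \<le> n\<close> into blocks \<open>i \<le> j < m\<close>, where \<open>i \<in> I\<close> and \<open>m\<close> is the
  next element of \<open>I \<union> {n + 1}\<close>.  For \<open>p \<ge> l\<close>, multiplying by \<open>s\<^sub>p\<close> from the right exchanges \<open>c\<^sub>p\<close> with
  \<open>c\<^sub>p\<^sub>+\<^sub>1\<close>, and turns every other \<open>c\<^sub>j\<close> into \<open>s\<^sub>p c\<^sub>j\<close> or \<open>s\<^sub>p\<^sub>+\<^sub>1 c\<^sub>j\<close>.  Hence the block sum
  \<open>q c\<^sub>i + \<dots> + q c\<^sub>m\<^sub>-\<^sub>1\<close> is invariant under \<open>s\<^sub>p\<close> as soon as the block contains both or none of \<open>p\<close> and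
  \<open>p + 1\<close>, and \<open>q\<close> absorbs the reflections that move to the left.  This puts the block
  sum into \<open>F(J)\<close>, where \<open>J\<close> arises from \<open>I\<close> by lowering all elements in \<open>[l, i]\<close> by one
  (\<open>block_sum_in_invariants\<close>).  One such element is \<open>i\<close> itself, so \<open>sum J < sum I\<close>.

  The set \<open>J\<close> need not be lacunar, but each \<open>F(J)\<close> with \<open>J \<subseteq> [n - 1]\<close> is contained in some \<open>F(K)\<close> with \<open>K\<close>
  lacunar and \<open>sum K \<le> sum J\<close> (\<open>invariants_le_lacunar\<close>).  The sets \<open>K\<close> so obtained precede \<open>I\<close> in
  any enumeration by increasing sum, which gives (c); and (b) follows from (c).  The same reduction
  applied to \<open>J = [n - 1]\<close> yields a lacunar \<open>K\<close> that imposes no invariance at all, so the filtration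
  ends with the whole group algebra.
\<close>

section \<open>Right translation\<close>

text \<open>
  For \<open>\<tau> \<in> S\<^sub>n\<close> this is the product \<open>q \<cdot> \<tau>\<close> in terms of coefficient functions.  It depends neither on
  \<open>n\<close> nor on the ring structure, so products with permutations can be rearranged without
  manipulating convolution sums.
\<close>

definition translate :: "((nat \<Rightarrow> nat) \<Rightarrow> 'k) \<Rightarrow> (nat \<Rightarrow> nat) \<Rightarrow> (nat \<Rightarrow> nat) \<Rightarrow> 'k" where
  "translate q \<tau> = (\<lambda>p. q (p \<circ> inv \<tau>))"

lemma translate_id [simp]: "translate q id = q"
  by (simp add: translate_def)

lemma translate_translate:
  assumes "bij \<sigma>" "bij \<tau>"
  shows "translate (translate q \<sigma>) \<tau> = translate q (\<sigma> \<circ> \<tau>)"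
  using assms by (simp add: translate_def o_inv_distrib comp_assoc)

lemma sum_fun_apply: "(\<Sum>j\<in>A. f j) x = (\<Sum>j\<in>A. f j x)"
  by (induction A rule: infinite_finite_induct) simp_all

lemma translate_sum: "translate (\<Sum>j\<in>A. f j) \<tau> = (\<Sum>j\<in>A. translate (f j) \<tau>)"
  by (rule ext) (simp add: translate_def sum_fun_apply)

lemma translate_in_group_algebra:
  assumes q: "q \<in> group_algebra n" and \<tau>: "\<tau> \<in> sym_group n"
  shows "translate q \<tau> \<in> group_algebra n"
proof -
  have "p \<in> sym_group n" if "p \<circ> inv \<tau> \<in> sym_group n" for p
  proof -
    have "p = p \<circ> inv \<tau> \<circ> \<tau>"
      using \<tau> by (simp add: sym_group_def comp_assoc permutes_inv_o)
    with that \<tau> show ?thesis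
      by (metis mem_Collect_eq permutes_compose sym_group_def)
  qed
  with q show ?thesis
    by (auto simp: group_algebra_def translate_def)
qed

lemma finite_sym_group: "finite (sym_group n)"
  by (simp add: sym_group_def finite_permutations)

lemma gmult_gbasis:
  fixes q :: "(nat \<Rightarrow> nat) \<Rightarrow> 'k :: {comm_ring, comm_monoid_mult}"
  assumes q: "q \<in> group_algebra n" and \<tau>: "\<tau> \<in> sym_group n"
  shows "gmult n q (gbasis \<tau>) = translate q \<tau>"
proof
  fix p
  let ?S = "{(\<sigma>, \<tau>'). (\<sigma>, \<tau>') \<in> sym_group n \<times> sym_group n \<and> \<sigma> \<circ> \<tau>' = p}"
  let ?x = "(p \<circ> inv \<tau>, \<tau>)"
  have fin: "finite ?S"
    by (rule finite_subset[of _ "sym_group n \<times> sym_group n"]) (auto simp: finite_sym_group)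
  have "gmult n q (gbasis \<tau>) p = (\<Sum>x\<in>?S. if x = ?x then q (p \<circ> inv \<tau>) else 0)"
    unfolding gmult_def gbasis_def
  proof (intro sum.cong refl)
    fix x assume "x \<in> ?S"
    moreover have "\<sigma> \<circ> \<tau> \<circ> inv \<tau> = \<sigma>" for \<sigma> :: "nat \<Rightarrow> nat"
      using \<tau> by (simp add: sym_group_def comp_assoc permutes_inv_o)
    ultimately show "(case x of (\<sigma>, \<tau>') \<Rightarrow> q \<sigma> * (if \<tau>' = \<tau> then 1 else 0))
        = (if x = ?x then q (p \<circ> inv \<tau>) else 0)"
      by (auto split: if_splits)
  qed
  also have "\<dots> = (if ?x \<in> ?S then q (p \<circ> inv \<tau>) else 0)"
    using fin by (subst sum.delta) auto
  also have "\<dots> = q (p \<circ> inv \<tau>)"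
  proof -
    have "p \<circ> inv \<tau> \<circ> \<tau> = p"
      using \<tau> by (simp add: sym_group_def comp_assoc permutes_inv_o)
    with q \<tau> show ?thesis by (auto simp: group_algebra_def)
  qed
  finally show "gmult n q (gbasis \<tau>) p = translate q \<tau> p"
    by (simp add: translate_def)
qed

lemma gmult_diff_right: "gmult n q (a - b) = gmult n q a - gmult n q b"
  by (rule ext) (simp add: gmult_def right_diff_distrib sum_subtractf case_prod_beta)

lemma gmult_add_left: "gmult n (a + b) c = gmult n a c + gmult n b c"
  by (rule ext) (simp add: gmult_def distrib_right sum.distrib case_prod_beta)

lemma gmult_add_right: "gmult n c (a + b) = gmult n c a + gmult n c b"
  by (rule ext) (simp add: gmult_def distrib_left sum.distrib case_prod_beta)

lemma gmult_zero_right: "gmult n c 0 = 0"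
  by (rule ext) (simp add: gmult_def case_prod_beta)

lemma gmult_zero_left: "gmult n 0 c = 0"
  by (rule ext) (simp add: gmult_def case_prod_beta)

lemma gmult_sum_right: "gmult n q (\<Sum>j\<in>A. f j) = (\<Sum>j\<in>A. gmult n q (f j))"
  by (induction A rule: infinite_finite_induct)
    (simp_all only: sum.infinite sum.empty sum.insert gmult_add_right gmult_zero_right
      not_False_eq_True)

lemma gmult_gnat:
  fixes q :: "(nat \<Rightarrow> nat) \<Rightarrow> 'k :: {comm_ring, comm_monoid_mult}"
  assumes "q \<in> group_algebra n"
  shows "gmult n q (gnat m) = (\<Sum>j<m. q)"
proof -
  have "id \<in> sym_group n"
    by (simp add: sym_group_def permutes_id)
  with assms show ?thesis
    by (simp add: gnat_def gmult_sum_right gmult_gbasis)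
qed

section \<open>Cycles of consecutive numbers\<close>

abbreviation cyc :: "nat \<Rightarrow> nat \<Rightarrow> nat \<Rightarrow> nat" where
  "cyc l j \<equiv> cycle_of_list [l..<Suc j]"

abbreviation adj :: "nat \<Rightarrow> nat \<Rightarrow> nat" where
  "adj p \<equiv> transpose p (Suc p)"

lemma cyc_step: "l < j \<Longrightarrow> cyc l j = adj l \<circ> cyc (Suc l) j"
  by (simp add: upt_conv_Cons del: upt_Suc)

lemma cyc_apply:
  "l \<le> j \<Longrightarrow> cyc l j x = (if l \<le> x \<and> x < j then Suc x else if x = j then l else x)"
proof (induction "j - l" arbitrary: l)
  case 0
  then show ?case by simp
next
  case (Suc d)
  then have lj: "l < j" and IH: "cyc (Suc l) j x =
      (if Suc l \<le> x \<and> x < j then Suc x else if x = j then Suc l else x)"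
    by auto
  show ?case
    unfolding cyc_step[OF lj] comp_apply IH using lj by (auto simp: transpose_def)
qed

lemma cyc_in_sym_group: "\<lbrakk>1 \<le> l; j \<le> n\<rbrakk> \<Longrightarrow> cyc l j \<in> sym_group n"
proof -
  assume "1 \<le> l" "j \<le> n"
  moreover have "cyc l j permutes set [l..<Suc j]"
    by (rule cycle_permutes)
  ultimately show ?thesis
    unfolding sym_group_def by (auto elim!: permutes_subset simp del: upt_Suc)
qed

lemma adj_in_sym_group: "p \<in> {1..n - 1} \<Longrightarrow> adj p \<in> sym_group n"
  by (auto simp: sym_group_def intro!: permutes_swap_id)

lemma bij_adj: "bij (adj p)"
  by simp

lemma bij_cyc: "bij (cyc l j)"
  using cycle_permutes permutes_bij by blast

lemma cyc_comp_adj_same: "l \<le> p \<Longrightarrow> cyc l p \<circ> adj p = cyc l (Suc p)"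
  by (rule ext) (auto simp: cyc_apply transpose_def simp del: upt_Suc)

lemma cyc_comp_adj_before: "l \<le> p \<Longrightarrow> cyc l (Suc p) \<circ> adj p = cyc l p"
  by (rule ext) (auto simp: cyc_apply transpose_def simp del: upt_Suc)

lemma cyc_comp_adj_beyond: "\<lbrakk>l \<le> j; j < p\<rbrakk> \<Longrightarrow> cyc l j \<circ> adj p = adj p \<circ> cyc l j"
  by (rule ext) (auto simp: cyc_apply transpose_def simp del: upt_Suc)

lemma cyc_comp_adj_below: "\<lbrakk>l \<le> j; Suc p < l\<rbrakk> \<Longrightarrow> cyc l j \<circ> adj p = adj p \<circ> cyc l j"
  by (rule ext) (auto simp: cyc_apply transpose_def simp del: upt_Suc)

lemma cyc_comp_adj_inside: "\<lbrakk>l \<le> p; Suc p < j\<rbrakk> \<Longrightarrow> cyc l j \<circ> adj p = adj (Suc p) \<circ> cyc l j"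
  by (rule ext) (auto simp: cyc_apply transpose_def simp del: upt_Suc)

text \<open>
  The commutation rules above in a single formula: up to a reflection that \<open>q\<close> absorbs,
  multiplication by \<open>s\<^sub>p\<close> permutes the elements \<open>q c\<^sub>j\<close> by acting on the index \<open>j\<close>.  Sums of \<open>q c\<^sub>j\<close> over
  sets of indices that are stable under this action are therefore invariant.
\<close>

lemma translate_cyc_adj:
  assumes "l \<le> j" "l \<le> p"
    and "j < p \<Longrightarrow> translate q (adj p) = q"
    and "Suc p < j \<Longrightarrow> translate q (adj (Suc p)) = q"
  shows "translate (translate q (cyc l j)) (adj p) = translate q (cyc l (adj p j))"
proof -
  consider "j < p" | "j = p" | "j = Suc p" | "Suc p < j" by linarith
  then show ?thesis
  proof cases
    case 1
    then have "translate (translate q (cyc l j)) (adj p)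
        = translate (translate q (adj p)) (cyc l j)"
      using assms(1) by (simp add: translate_translate bij_cyc cyc_comp_adj_beyond del: upt_Suc)
    with 1 assms show ?thesis by (simp add: transpose_def del: upt_Suc)
  next
    case 4
    then have "translate (translate q (cyc l j)) (adj p)
        = translate (translate q (adj (Suc p))) (cyc l j)"
      using assms(2) by (simp add: translate_translate bij_cyc cyc_comp_adj_inside del: upt_Suc)
    with 4 assms show ?thesis by (simp add: transpose_def del: upt_Suc)
  qed (use assms in \<open>simp_all add: translate_translate bij_cyc cyc_comp_adj_same
        cyc_comp_adj_before del: upt_Suc\<close>)
qed

lemma translate_cyc_fixed:
  assumes "l \<le> a" "a \<le> j"
    and "\<And>p. \<lbrakk>l \<le> p; p < a\<rbrakk> \<Longrightarrow> translate q (adj p) = q"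
  shows "translate q (cyc l j) = translate q (cyc a j)"
  using assms
proof (induction "a - l" arbitrary: l)
  case 0
  then show ?case by simp
next
  case (Suc d)
  then have "l < j" "l < a" by auto
  have "translate q (cyc l j) = translate (translate q (adj l)) (cyc (Suc l) j)"
    unfolding cyc_step[OF \<open>l < j\<close>] translate_translate[OF bij_adj bij_cyc] ..
  also have "\<dots> = translate q (cyc (Suc l) j)"
    using Suc.prems \<open>l < a\<close> by simp
  also have "\<dots> = translate q (cyc a j)"
    using Suc.hyps(2) \<open>l < a\<close> by (intro Suc.hyps(1)) (use Suc.prems in auto)
  finally show ?case .
qed

section \<open>The invariant spaces and their lacunar indices\<close>

lemma invariants_iff:
  "q \<in> invariants n I \<longleftrightarrow>
    q \<in> group_algebra n \<and> (\<forall>p\<in>nonshadow n I. translate q (adj p) = q)"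
proof -
  have "gmult n q (gbasis (cycle_of_list [p, p + 1])) = translate q (adj p)"
    if "q \<in> group_algebra n" "p \<in> nonshadow n I" for p
    using that adj_in_sym_group[of p n] by (simp add: nonshadow_def gmult_gbasis)
  then show ?thesis
    by (auto simp: invariants_def)
qed

lemma invariants_antimono:
  "nonshadow n I \<subseteq> nonshadow n J \<Longrightarrow> invariants n J \<subseteq> invariants n I"
  by (meson invariants_iff subset_iff)

lemma group_algebra_zero: "0 \<in> group_algebra n"
  by (simp add: group_algebra_def)

lemma group_algebra_diff:
  "\<lbrakk>a \<in> group_algebra n; b \<in> group_algebra n\<rbrakk> \<Longrightarrow> a - b \<in> group_algebra n"
  by (simp add: group_algebra_def)

lemma group_algebra_sum:
  "(\<And>j. j \<in> A \<Longrightarrow> f j \<in> group_algebra n) \<Longrightarrow> (\<Sum>j\<in>A. f j) \<in> group_algebra n"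
  by (simp add: group_algebra_def sum_fun_apply)

lemma invariants_zero: "0 \<in> invariants n I"
  by (auto simp: invariants_iff group_algebra_zero translate_def)

lemma invariants_diff:
  "\<lbrakk>a \<in> invariants n I; b \<in> invariants n I\<rbrakk> \<Longrightarrow> a - b \<in> invariants n I"
  by (auto simp: invariants_iff group_algebra_diff translate_def fun_eq_iff)

text \<open>
  Say that \<open>J\<close> shadows \<open>p\<close> if \<open>p \<in> J\<close> or \<open>p + 1 \<in> J\<close>; then \<open>F(J)\<close> imposes no condition at \<open>p\<close>.
  Both constructions of new index sets below lower some elements by one.  An element \<open>1\<close>
  is thereby lowered to \<open>0\<close>, which is not an admissible index and is discarded; this changes no
  invariance condition, because \<open>0\<close> only shadows \<open>0\<close> and \<open>-1\<close>.
\<close>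

lemma sum_shift_down_less:
  fixes g :: "nat \<Rightarrow> nat"
  assumes "finite I" "\<And>x. x \<in> I \<Longrightarrow> g x \<le> x" "i \<in> I" "g i < i"
  shows "\<Sum>(g ` I - {0}) < \<Sum>I"
proof -
  have "\<Sum>(g ` I - {0}) \<le> \<Sum>(g ` I)"
    using assms by (intro sum_mono2) auto
  also have "\<dots> \<le> (\<Sum>x\<in>I. g x)"
    using sum_image_le[of I "\<lambda>x. x" g] assms by (simp add: comp_def)
  also have "\<dots> < \<Sum>I"
    using assms by (intro sum_strict_mono_ex1) auto
  finally show ?thesis .
qed

text \<open>
  If \<open>i, i + 1 \<in> J\<close>, then \<open>i\<close> and \<open>i + 1\<close> together shadow \<open>{i - 1, i, i + 1}\<close>, and so do \<open>i - 1\<close> and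
  \<open>i + 1\<close> (even \<open>i - 2\<close> in addition).  Replacing \<open>i\<close> by \<open>i - 1\<close> thus loses no shadow but lowers the
  sum, so that iterating ends at a lacunar set.
\<close>

lemma exists_lacunar_nonshadow_subset:
  assumes "J \<subseteq> {1..n - 1}"
  shows "\<exists>K \<subseteq> {1..n - 1}. lacunar K \<and> nonshadow n K \<subseteq> nonshadow n J \<and> \<Sum>K \<le> \<Sum>J"
  using assms
proof (induction "\<Sum>J" arbitrary: J rule: less_induct)
  case less
  show ?case
  proof (cases "lacunar J")
    case True
    with less.prems show ?thesis by blast
  next
    case False
    then obtain i where i: "i \<in> J" "Suc i \<in> J"
      by (auto simp: lacunar_def)
    define g where "g = (\<lambda>x. if x = i then i - 1 else x)"
    define J' where "J' = g ` J - {0}"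
    have fin: "finite J"
      using less.prems finite_subset by blast
    have i1: "1 \<le> i"
      using i less.prems by auto
    have "J' \<subseteq> {1..n - 1}"
      using less.prems i1 by (force simp: J'_def g_def)
    moreover have lt: "\<Sum>J' < \<Sum>J"
      unfolding J'_def by (rule sum_shift_down_less[OF fin _ i(1)]) (use i1 in \<open>auto simp: g_def\<close>)
    ultimately obtain K where K: "K \<subseteq> {1..n - 1}" "lacunar K"
        "nonshadow n K \<subseteq> nonshadow n J'" "\<Sum>K \<le> \<Sum>J'"
      using less.hyps by blast
    have "nonshadow n J' \<subseteq> nonshadow n J"
    proof
      fix p assume p: "p \<in> nonshadow n J'"
      have shifted: "g x \<in> J'" if "x \<in> J" "g x \<noteq> 0" for x
        using that by (auto simp: J'_def)
      show "p \<in> nonshadow n J"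
        using p shifted[of p] shifted[of "Suc p"] shifted[of i] shifted[of "Suc i"] i
        by (cases "p = i"; cases "Suc p = i") (auto simp: nonshadow_def g_def)
    qed
    with K lt show ?thesis
      by (intro exI[of _ K]) auto
  qed
qed

lemma invariants_le_lacunar:
  assumes "J \<subseteq> {1..n - 1}"
  obtains K where "K \<subseteq> {1..n - 1}" "lacunar K" "invariants n J \<subseteq> invariants n K" "\<Sum>K \<le> \<Sum>J"
  using exists_lacunar_nonshadow_subset[OF assms] invariants_antimono by meson

section \<open>Block sums\<close>

text \<open>
  A reflection \<open>s\<^sub>p\<close> with \<open>p \<ge> l\<close> preserves the block unless \<open>p = i - 1\<close> or \<open>p = m - 1\<close>, and both of
  these are shadowed by \<open>J\<close>: the first by the lowered \<open>i\<close>, the second by \<open>m\<close>, which is not lowered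
  (if \<open>m = n + 1\<close>, then \<open>p = n\<close> is out of range).
  For \<open>l \<le> p \<le> i - 2\<close> it is \<open>s\<^sub>p\<^sub>+\<^sub>1\<close> that \<open>q\<close> has to absorb, whence the lowering in \<open>[l, i]\<close>; for \<open>p\<close> inside
  the block the absorption comes from the gap between \<open>i\<close> and \<open>m\<close>, and for \<open>p \<ge> m\<close> from the
  fact that the elements above \<open>i\<close> stay in place.  Reflections with \<open>p < l - 1\<close>
  commute with all the cycles.  The remaining value \<open>p = l - 1\<close> is the reason for assuming that
  \<open>l\<close> or \<open>l + 1\<close> belongs to \<open>I\<close>: then \<open>J\<close> shadows it.
\<close>

lemma block_sum_in_invariants:
  assumes I: "I \<subseteq> {1..n - 1}" and q: "q \<in> invariants n I"
    and l: "1 \<le> l" "l \<in> I \<or> Suc l \<in> I"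
    and i: "i \<in> I" "l \<le> i" and lt: "i < m" and m: "m \<in> I \<or> m = n + 1"
    and gap: "\<And>x. x \<in> I \<Longrightarrow> x \<le> i \<or> m \<le> x"
  obtains J where "J \<subseteq> {1..n - 1}" "\<Sum>J < \<Sum>I"
    "(\<Sum>j\<in>{i..<m}. translate q (cyc l j)) \<in> invariants n J"
proof -
  define g where "g = (\<lambda>x. if l \<le> x \<and> x \<le> i then x - 1 else x)"
  define J where "J = g ` I - {0}"
  let ?v = "\<Sum>j\<in>{i..<m}. translate q (cyc l j)"
  have mn: "m \<le> n + 1" and qG: "q \<in> group_algebra n"
    using m I q by (fastforce simp: invariants_iff)+
  have fixq: "translate q (adj p) = q" if "p \<in> {1..n - 1}" "p \<notin> I" "Suc p \<notin> I" for p
    using that q by (auto simp: invariants_iff nonshadow_def)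
  have shifted: "g x \<in> J" if "x \<in> I" "g x \<noteq> 0" for x
    using that by (auto simp: J_def)
  have "translate ?v (adj p) = ?v" if "p \<in> nonshadow n J" for p
  proof -
    \<comment> \<open>All cases have one pattern: an element of \<open>I\<close> that obstructs the absorption would, after
      lowering, put \<open>p\<close> or \<open>p + 1\<close> into \<open>J\<close>.\<close>
    from that have p: "p \<in> {1..n - 1}" "p \<notin> J" "Suc p \<notin> J"
      by (auto simp: nonshadow_def)
    have "p \<noteq> l - 1"
      using p l i shifted[of l] shifted[of "Suc l"] by (cases "l = i") (auto simp: g_def)
    moreover have "p \<noteq> i - 1" "p \<noteq> m - 1"
      using p i lt m shifted[of i] shifted[of m] by (auto simp: g_def)
    ultimately have p_ne: "p \<noteq> l - 1" "p \<noteq> i - 1" "p \<noteq> m - 1" .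
    show ?thesis
    proof (cases "l \<le> p")
      case False
      with p_ne have "Suc p < l" by auto
      then have "translate q (adj p) = q"
        using p shifted[of p] shifted[of "Suc p"] by (intro fixq) (auto simp: g_def)
      moreover have "translate (translate q (cyc l j)) (adj p)
          = translate (translate q (adj p)) (cyc l j)" if "l \<le> j" for j
        using that \<open>Suc p < l\<close>
        by (simp add: translate_translate bij_cyc cyc_comp_adj_below del: upt_Suc)
      ultimately have "translate (translate q (cyc l j)) (adj p) = translate q (cyc l j)"
        if "l \<le> j" for j
        using that by simp
      with i show ?thesis
        by (simp add: translate_sum del: upt_Suc)
    next
      case True
      have "translate (translate q (cyc l j)) (adj p) = translate q (cyc l (adj p j))"
        if j: "j \<in> {i..<m}" for j
      proof (rule translate_cyc_adj)
        assume "j < p"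
        show "translate q (adj p) = q"
        proof (rule fixq)
          show "p \<notin> I" "Suc p \<notin> I"
            using p j \<open>j < p\<close> shifted[of p] shifted[of "Suc p"]
            by (auto simp: g_def)
        qed (use p in auto)
      next
        assume "Suc p < j"
        show "translate q (adj (Suc p)) = q"
        proof (rule fixq)
          show "Suc p \<notin> I"
            using p p_ne j \<open>Suc p < j\<close> shifted[of "Suc p"] gap[of "Suc p"] True l
            by (auto simp: g_def split: if_splits)
          show "Suc (Suc p) \<notin> I"
            using p p_ne j \<open>Suc p < j\<close> shifted[of "Suc (Suc p)"] gap[of "Suc (Suc p)"] True l
            by (auto simp: g_def split: if_splits)
        qed (use j mn \<open>Suc p < j\<close> in auto)
      qed (use j i True in auto)
      then have "translate ?v (adj p) = (\<Sum>j\<in>{i..<m}. translate q (cyc l (adj p j)))"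
        by (simp add: translate_sum del: upt_Suc)
      also have "\<dots> = ?v"
        by (rule sum.reindex_bij_witness[of _ "adj p" "adj p"])
          (use p_ne in \<open>auto simp: transpose_def simp del: upt_Suc split: if_splits\<close>)
      finally show ?thesis .
    qed
  qed
  moreover have "?v \<in> group_algebra n"
    using l i lt mn qG
    by (intro group_algebra_sum translate_in_group_algebra cyc_in_sym_group) auto
  ultimately have "?v \<in> invariants n J"
    by (simp add: invariants_iff)
  moreover have "J \<subseteq> {1..n - 1}"
    using I by (force simp: J_def g_def)
  moreover have "\<Sum>J < \<Sum>I"
    unfolding J_def
    by (rule sum_shift_down_less[OF _ _ i(1)])
      (use I finite_subset l i in \<open>auto simp: g_def\<close>)
  ultimately show thesis using that by blast
qed


section \<open>Reduction of \<open>q t\<^sub>l\<close> modulo smaller index sets\<close>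

text \<open>
  Splits the range of summation into blocks.  The sum of the smaller spaces is replaced by an
  arbitrary additively closed \<open>M\<close> containing them, so that the result applies to any member of a
  filtration in which they have already occurred.
\<close>

lemma tail_in_span:
  fixes M :: "((nat \<Rightarrow> nat) \<Rightarrow> 'k :: {comm_ring, comm_monoid_mult}) set"
  assumes I: "I \<subseteq> {1..n - 1}" and q: "q \<in> invariants n I"
    and l: "1 \<le> l" "l \<in> I \<or> Suc l \<in> I"
    and M0: "0 \<in> M" and Madd: "\<And>a b. \<lbrakk>a \<in> M; b \<in> M\<rbrakk> \<Longrightarrow> a + b \<in> M"
    and Minv: "\<And>J. \<lbrakk>J \<subseteq> {1..n - 1}; \<Sum>J < \<Sum>I\<rbrakk> \<Longrightarrow> invariants n J \<subseteq> M"
    and i: "i \<in> I \<or> i = n + 1" "l \<le> i"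
  shows "(\<Sum>j\<in>{i..n}. translate q (cyc l j)) \<in> M"
  using i
proof (induction "n + 1 - i" arbitrary: i rule: less_induct)
  case less
  show ?case
  proof (cases "i \<in> I")
    case False
    with less.prems have "i = n + 1" by simp
    then have "(\<Sum>j\<in>{i..n}. translate q (cyc l j)) = 0"
      by (simp only: atLeastatMost_empty sum.empty less_add_one)
    with M0 show ?thesis by simp
  next
    case True
    define m where "m = (LEAST x. (x \<in> I \<or> x = n + 1) \<and> i < x)"
    have "i \<le> n" using True I by fastforce
    then have m: "(m \<in> I \<or> m = n + 1) \<and> i < m"
      using LeastI[of "\<lambda>x. (x \<in> I \<or> x = n + 1) \<and> i < x" "n + 1", folded m_def] by simp
    have gap: "x \<le> i \<or> m \<le> x" if "x \<in> I" for x
      using that Least_le[of "\<lambda>x. (x \<in> I \<or> x = n + 1) \<and> i < x" x, folded m_def] by linarith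
    have mn: "m \<le> n + 1" using m I by auto
    obtain J where "J \<subseteq> {1..n - 1}" "\<Sum>J < \<Sum>I"
        "(\<Sum>j\<in>{i..<m}. translate q (cyc l j)) \<in> invariants n J"
      using block_sum_in_invariants[OF I q l True less.prems(2) m[THEN conjunct2]
          m[THEN conjunct1] gap] by blast
    then have "(\<Sum>j\<in>{i..<m}. translate q (cyc l j)) \<in> M"
      using Minv by blast
    moreover have "(\<Sum>j\<in>{m..n}. translate q (cyc l j)) \<in> M"
      using less.hyps[of m] m \<open>i \<le> n\<close> less.prems by auto
    moreover have "{i..n} = {i..<m} \<union> {m..n}" using m mn by auto
    then have "(\<Sum>j\<in>{i..n}. translate q (cyc l j))
        = (\<Sum>j\<in>{i..<m}. translate q (cyc l j)) + (\<Sum>j\<in>{m..n}. translate q (cyc l j))"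
      by (simp only: sum.union_disjoint[OF finite_atLeastLessThan finite_atLeastAtMost ivl_disj_int_two(7)])
    ultimately show ?thesis using Madd by metis
  qed
qed

lemma cyc_refl: "cyc l l = id"
  by simp

lemma gmult_somewhere_to_below:
  fixes q :: "(nat \<Rightarrow> nat) \<Rightarrow> 'k :: {comm_ring, comm_monoid_mult}"
  assumes "q \<in> group_algebra n" "1 \<le> l"
  shows "gmult n q (somewhere_to_below n l) = (\<Sum>j\<in>{l..n}. translate q (cyc l j))"
  unfolding somewhere_to_below_def gmult_sum_right
  by (intro sum.cong refl gmult_gbasis cyc_in_sym_group) (use assms in auto)

text \<open>
  The congruence \<open>q t\<^sub>l \<equiv> m\<^sub>I\<^sub>,\<^sub>l q\<close> modulo smaller index sets: the cycles that end before the first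
  element of \<open>I\<close> at or above \<open>l\<close> contribute the scalar, the others are block sums.
\<close>

lemma somewhere_to_below_minus_mdist:
  fixes M :: "((nat \<Rightarrow> nat) \<Rightarrow> 'k :: {comm_ring, comm_monoid_mult}) set"
  assumes I: "I \<subseteq> {1..n - 1}" and q: "q \<in> invariants n I" and l: "l \<in> {1..n}"
    and M0: "0 \<in> M" and Madd: "\<And>a b. \<lbrakk>a \<in> M; b \<in> M\<rbrakk> \<Longrightarrow> a + b \<in> M"
    and Minv: "\<And>J. \<lbrakk>J \<subseteq> {1..n - 1}; \<Sum>J < \<Sum>I\<rbrakk> \<Longrightarrow> invariants n J \<subseteq> M"
  shows "gmult n q (somewhere_to_below n l - gnat (mdist n I l)) \<in> M"
proof -
  define k where "k = (LEAST x. x \<in> hat n I \<and> l \<le> x)"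
  have k: "k \<in> hat n I \<and> l \<le> k"
    unfolding k_def by (rule LeastI[of _ "n + 1"]) (use l in \<open>auto simp: hat_def\<close>)
  have kI: "k \<in> I \<or> k = n + 1" and kn: "k \<le> n + 1"
    using k l I by (auto simp: hat_def)
  have gap: "x \<notin> I" if "l \<le> x" "x < k" for x
    using that not_less_Least[of x "\<lambda>x. x \<in> hat n I \<and> l \<le> x"] by (auto simp: k_def hat_def)
  have qG: "q \<in> group_algebra n" using q by (simp add: invariants_iff)
  have fixq: "translate q (adj p) = q" if "l \<le> p" "Suc p < k" for p
    using that q l kn gap[of p] gap[of "Suc p"] by (auto simp: invariants_iff nonshadow_def)
  \<comment> \<open>The cycles with \<open>j \<ge> k\<close> can be started at \<open>a\<close> instead of \<open>l\<close>, because \<open>q\<close> absorbs \<open>s\<^sub>l, \<dots>, s\<^sub>a\<^sub>-\<^sub>1\<close>.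
    This establishes the condition on the starting point under which block sums can be treated.\<close>
  define a where "a = (if l = k then l else k - 1)"
  have a: "l \<le> a" "a \<le> k" using k by (auto simp: a_def)
  have "(\<Sum>j\<in>{l..<k}. translate q (cyc l j)) = (\<Sum>j\<in>{l..<k}. q)"
  proof (intro sum.cong refl)
    fix j assume j: "j \<in> {l..<k}"
    have "translate q (cyc l j) = translate q (cyc j j)"
      by (rule translate_cyc_fixed) (use j fixq in auto)
    then show "translate q (cyc l j) = q"
      unfolding cyc_refl by simp
  qed
  also have "\<dots> = (\<Sum>j<k - l. q)"
    by (rule sum.reindex_bij_witness[of _ "\<lambda>j. j + l" "\<lambda>j. j - l"]) auto
  finally have head: "(\<Sum>j\<in>{l..<k}. translate q (cyc l j)) = (\<Sum>j<k - l. q)" .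
  have tail_eq: "(\<Sum>j\<in>{k..n}. translate q (cyc l j)) = (\<Sum>j\<in>{k..n}. translate q (cyc a j))"
    by (intro sum.cong refl translate_cyc_fixed) (use a fixq in \<open>auto simp: a_def split: if_splits\<close>)
  have tail: "(\<Sum>j\<in>{k..n}. translate q (cyc a j)) \<in> M"
  proof (cases "k = n + 1")
    case True
    then have "(\<Sum>j\<in>{k..n}. translate q (cyc a j)) = 0"
      by (simp only: atLeastatMost_empty sum.empty less_add_one)
    with M0 show ?thesis by simp
  next
    case False
    with kI have "k \<in> I" by simp
    then have "a \<in> I \<or> Suc a \<in> I" "1 \<le> a"
      using a l by (auto simp: a_def)
    with \<open>k \<in> I\<close> show ?thesis
      by (intro tail_in_span[OF I q _ _ M0 Madd Minv]) (use a in auto)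
  qed
  have "{l..n} = {l..<k} \<union> {k..n}" using k kn by auto
  then have "(\<Sum>j\<in>{l..n}. translate q (cyc l j))
      = (\<Sum>j\<in>{l..<k}. translate q (cyc l j)) + (\<Sum>j\<in>{k..n}. translate q (cyc l j))"
    by (simp only: sum.union_disjoint[OF finite_atLeastLessThan finite_atLeastAtMost ivl_disj_int_two(7)])
  then have "gmult n q (somewhere_to_below n l) - gmult n q (gnat (k - l))
      = (\<Sum>j\<in>{k..n}. translate q (cyc a j))"
    using l by (simp only: gmult_somewhere_to_below[OF qG] gmult_gnat[OF qG] head tail_eq
        add_diff_cancel_left' atLeastAtMost_iff)
  with tail show ?thesis
    by (simp only: gmult_diff_right mdist_def k_def)
qed

section \<open>Sums of sets\<close>

lemma set_sum_mem_iff: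
  "finite A \<Longrightarrow> x \<in> (\<Sum>j\<in>A. S j) \<longleftrightarrow> (\<exists>s. (\<forall>j\<in>A. s j \<in> S j) \<and> x = (\<Sum>j\<in>A. s j))"
  by (auto simp: set_sum_alt)

lemma set_sum_diff:
  fixes S :: "'i \<Rightarrow> 'a :: ab_group_add set"
  assumes "finite A" "\<And>j a b. \<lbrakk>j \<in> A; a \<in> S j; b \<in> S j\<rbrakk> \<Longrightarrow> a - b \<in> S j"
    and "x \<in> (\<Sum>j\<in>A. S j)" "y \<in> (\<Sum>j\<in>A. S j)"
  shows "x - y \<in> (\<Sum>j\<in>A. S j)"
proof -
  obtain s t where "\<forall>j\<in>A. s j \<in> S j" "x = (\<Sum>j\<in>A. s j)" "\<forall>j\<in>A. t j \<in> S j" "y = (\<Sum>j\<in>A. t j)"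
    using assms by (auto simp: set_sum_mem_iff)
  then show ?thesis
    using assms by (auto simp: set_sum_mem_iff sum_subtractf intro!: exI[of _ "\<lambda>j. s j - t j"])
qed

lemma set_sum_mono_index:
  fixes S :: "'i \<Rightarrow> 'a :: comm_monoid_add set"
  assumes "finite B" "A \<subseteq> B" "\<And>j. j \<in> B \<Longrightarrow> 0 \<in> S j"
  shows "(\<Sum>j\<in>A. S j) \<subseteq> (\<Sum>j\<in>B. S j)"
proof
  fix x assume "x \<in> (\<Sum>j\<in>A. S j)"
  then obtain s where s: "\<forall>j\<in>A. s j \<in> S j" "x = (\<Sum>j\<in>A. s j)"
    using finite_subset[OF assms(2,1)] by (auto simp: set_sum_mem_iff)
  have "(\<Sum>j\<in>B. if j \<in> A then s j else 0) = (\<Sum>j\<in>A. s j)"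
    using assms by (simp add: sum.If_cases Int_absorb1)
  with s assms show "x \<in> (\<Sum>j\<in>B. S j)"
    by (auto simp: set_sum_mem_iff intro!: exI[of _ "\<lambda>j. if j \<in> A then s j else 0"])
qed

lemma set_sum_least:
  fixes S :: "'i \<Rightarrow> 'a :: comm_monoid_add set"
  assumes "finite A" "0 \<in> M" "\<And>a b. \<lbrakk>a \<in> M; b \<in> M\<rbrakk> \<Longrightarrow> a + b \<in> M" "\<And>j. j \<in> A \<Longrightarrow> S j \<subseteq> M"
  shows "(\<Sum>j\<in>A. S j) \<subseteq> M"
proof
  fix x assume "x \<in> (\<Sum>j\<in>A. S j)"
  then obtain s where s: "\<forall>j\<in>A. s j \<in> S j" "x = (\<Sum>j\<in>A. s j)"
    using assms by (auto simp: set_sum_mem_iff)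
  have "(\<Sum>j\<in>B. s j) \<in> M" if "B \<subseteq> A" for B
    using finite_subset[OF that assms(1)] that
    by (induction B) (use assms(2-4) s(1) in \<open>auto simp: subset_iff\<close>)
  with s show "x \<in> M" by blast
qed

section \<open>The filtration\<close>

theorem theorem8p1:
  fixes n :: nat
    and Q :: "nat \<Rightarrow> nat set"
    and F :: "nat \<Rightarrow> ((nat \<Rightarrow> nat) \<Rightarrow> 'k :: {comm_ring, comm_monoid_mult}) set"
  assumes Q_enum: "bij_betw Q {1..fib (n + 1)} {I. I \<subseteq> {1..n - 1} \<and> lacunar I}"
    and Q_sorted: "\<And>i j. 1 \<le> i \<Longrightarrow> i \<le> j \<Longrightarrow> j \<le> fib (n + 1) \<Longrightarrow> \<Sum>(Q i) \<le> \<Sum>(Q j)"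
    and F_def: "\<And>i. i \<le> fib (n + 1) \<Longrightarrow> F i = (\<Sum>j\<in>{1..i}. invariants n (Q j))"
  shows "(F 0 = {0} \<and> (\<forall>i < fib (n + 1). F i \<subseteq> F (i + 1)) \<and> F (fib (n + 1)) = group_algebra n)
    \<and> (\<forall>i \<in> {0..fib (n + 1)}. \<forall>l \<in> {1..n}. \<forall>q \<in> F i.
         gmult n q (somewhere_to_below n l) \<in> F i)
    \<and> (\<forall>i \<in> {1..fib (n + 1)}. \<forall>l \<in> {1..n}. \<forall>q \<in> F i.
         gmult n q (somewhere_to_below n l - gnat (mdist n (Q i) l)) \<in> F (i - 1))"
proof -
  let ?N = "fib (n + 1)"
  let ?t = "somewhere_to_below n :: nat \<Rightarrow> (nat \<Rightarrow> nat) \<Rightarrow> 'k"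
  have F_diff: "a - b \<in> F i" if "i \<le> ?N" "a \<in> F i" "b \<in> F i" for i a b
    using that(2,3) unfolding F_def[OF that(1)]
    by (intro set_sum_diff[OF finite_atLeastAtMost] invariants_diff)
  have F_mono: "F i \<subseteq> F j" if "i \<le> j" "j \<le> ?N" for i j
    using that by (simp add: F_def set_sum_mono_index invariants_zero)
  have F0: "F 0 = {0}"
    using F_def[of 0] by simp
  have F_zero: "0 \<in> F i" if "i \<le> ?N" for i
    using F_mono[of 0 i] F0 that by auto
  have F_add: "a + b \<in> F i" if "i \<le> ?N" "a \<in> F i" "b \<in> F i" for i a b
    using F_diff[of i a "0 - b"] F_diff[of i 0 b] F_zero that
    by (simp only: diff_0 diff_minus_eq_add)
  have F_contains: "invariants n (Q j) \<subseteq> F i" if "j \<in> {1..i}" "i \<le> ?N" for i j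
    using set_sum_mono_index[of "{1..i}" "{j}" "\<lambda>j. invariants n (Q j)"] that
    by (simp add: F_def invariants_zero)
  have F_least: "F i \<subseteq> M"
    if "i \<le> ?N" "0 \<in> M" "\<And>a b. \<lbrakk>a \<in> M; b \<in> M\<rbrakk> \<Longrightarrow> a + b \<in> M"
      "\<And>j. j \<in> {1..i} \<Longrightarrow> invariants n (Q j) \<subseteq> M" for i M
    unfolding F_def[OF that(1)] by (rule set_sum_least) (use that(2-4) in auto)
  have F_multiple: "(\<Sum>j<m. q) \<in> F i" if "i \<le> ?N" "q \<in> F i" for i q and m :: nat
    by (induction m) (simp_all only: lessThan_0 sum.empty sum.lessThan_Suc that F_zero F_add)
  have F_algebra: "F i \<subseteq> group_algebra n" if "i \<le> ?N" for i
    by (rule F_least[OF that]) (auto simp: group_algebra_def invariants_iff)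
  have Q_in: "Q j \<subseteq> {1..n - 1} \<and> lacunar (Q j)" if "j \<in> {1..?N}" for j
    using bij_betwE[OF Q_enum] that by blast
  have Q_onto: "\<exists>j\<in>{1..?N}. K = Q j" if "K \<subseteq> {1..n - 1}" "lacunar K" for K
  proof -
    have "K \<in> Q ` {1..?N}" using Q_enum that by (simp add: bij_betw_def)
    then show ?thesis by blast
  qed

  \<comment> \<open>Any \<open>J\<close> with smaller sum than \<open>Q j\<close> reduces to a lacunar set of smaller sum than \<open>Q j\<close>, which
    must be listed before \<open>Q j\<close>.\<close>
  have step: "gmult n q (?t l - gnat (mdist n (Q j) l)) \<in> F (j - 1)"
    if j: "j \<in> {1..?N}" and l: "l \<in> {1..n}" and q: "q \<in> invariants n (Q j)" for j l q
  proof (rule somewhere_to_below_minus_mdist[OF _ q l])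
    fix J assume J: "J \<subseteq> {1..n - 1}" "\<Sum>J < \<Sum>(Q j)"
    obtain K where K: "K \<subseteq> {1..n - 1}" "lacunar K" "\<Sum>K \<le> \<Sum>J"
        "(invariants n J :: ((nat \<Rightarrow> nat) \<Rightarrow> 'k) set) \<subseteq> invariants n K"
      using invariants_le_lacunar[OF J(1)] by metis
    then obtain k where k: "k \<in> {1..?N}" "K = Q k"
      using Q_onto by blast
    have "k < j"
      using Q_sorted[of j k] j k J K by force
    then have "invariants n (Q k) \<subseteq> F (j - 1)"
      using k j by (intro F_contains) auto
    with K(4) k show "invariants n J \<subseteq> F (j - 1)" by (metis order.trans)
  qed (use j Q_in F_zero F_add in auto)

  have c: "gmult n q (?t l - gnat (mdist n (Q i) l)) \<in> F (i - 1)"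
    if i: "i \<in> {1..?N}" and l: "l \<in> {1..n}" and q: "q \<in> F i" for i l q
  proof -
    let ?M = "{q. gmult n q (?t l - gnat (mdist n (Q i) l)) \<in> F (i - 1)}"
    have le: "i - 1 \<le> ?N" "i \<le> ?N" using i by auto
    have "F i \<subseteq> ?M"
    proof (rule F_least[OF le(2)])
      fix j assume j: "j \<in> {1..i}"
      show "invariants n (Q j) \<subseteq> ?M"
      proof
        fix r :: "(nat \<Rightarrow> nat) \<Rightarrow> 'k"
        assume r: "r \<in> invariants n (Q j)"
        show "r \<in> ?M"
        proof (cases "j = i")
          case True
          with step[OF i l] r show ?thesis by simp
        next
          case False
          then have ji: "j \<in> {1..i - 1}" "j \<in> {1..?N}" "j - 1 \<le> i - 1" using j le by auto
          have rF: "r \<in> F (i - 1)" and rG: "r \<in> group_algebra n"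
            using F_contains[OF ji(1) le(1)] r by (auto simp: invariants_iff)
          \<comment> \<open>The wrong scalar does no harm, as multiples of \<open>r\<close> already lie in \<open>F (i - 1)\<close>.\<close>
          have "gmult n r (?t l - gnat (mdist n (Q i) l)) =
              gmult n r (?t l - gnat (mdist n (Q j) l))
              + (gmult n r (gnat (mdist n (Q j) l)) - gmult n r (gnat (mdist n (Q i) l)))"
            by (simp only: gmult_diff_right diff_add_cancel add_diff_eq)
          also have "\<dots> \<in> F (i - 1)"
            using step[OF ji(2) l r] F_mono[OF ji(3) le(1)]
            by (intro F_add F_diff le(1)) (simp_all only: gmult_gnat[OF rG] F_multiple[OF le(1) rF] subsetD)
          finally show ?thesis by simp
        qed
      qed
    qed (simp_all only: mem_Collect_eq gmult_zero_left gmult_add_left F_zero[OF le(1)] F_add[OF le(1)])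
    with q show ?thesis by blast
  qed

  have b: "gmult n q (?t l) \<in> F i" if i: "i \<in> {0..?N}" and l: "l \<in> {1..n}" and q: "q \<in> F i" for i l q
  proof (cases "i = 0")
    case True
    with q F0 show ?thesis by (simp only: gmult_zero_left singleton_iff)
  next
    case False
    then have i': "i \<in> {1..?N}" "i \<le> ?N" using i by auto
    have "gmult n q (?t l - gnat (mdist n (Q i) l)) \<in> F i"
      using c[OF i'(1) l q] F_mono[of "i - 1" i] i' by auto
    moreover have "gmult n q (gnat (mdist n (Q i) l)) \<in> F i"
      using F_algebra[OF i'(2)] q F_multiple[OF i'(2) q] by (subst gmult_gnat) auto
    ultimately have "gmult n q (?t l - gnat (mdist n (Q i) l))
        + gmult n q (gnat (mdist n (Q i) l)) \<in> F i"
      by (rule F_add[OF i'(2)])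
    then show ?thesis by (simp only: gmult_diff_right diff_add_cancel)
  qed

  have "group_algebra n \<subseteq> F ?N"
  proof -
    obtain K where K: "K \<subseteq> {1..n - 1}" "lacunar K" "nonshadow n K \<subseteq> nonshadow n {1..n - 1}"
      using exists_lacunar_nonshadow_subset[of "{1..n - 1}" n] by blast
    then have "nonshadow n K = {}" by (auto simp: nonshadow_def)
    then have "group_algebra n \<subseteq> invariants n K" by (auto simp: invariants_iff)
    with Q_onto[OF K(1,2)] F_contains show ?thesis by blast
  qed
  with F_algebra have top: "F ?N = group_algebra n" by blast
  show ?thesis
  proof (intro conjI ballI allI impI)
    fix i assume "i < ?N"
    then show "F i \<subseteq> F (i + 1)" by (intro F_mono) simp_all
  qed (fact F0 top b c)+
qed

end
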